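(* Let $n\ge 2$, $0<s<1$, $0<p,q<\infty$ and $sp<n$, and let $u^*\in\dot{W}^{s,p}_q(\mathbb{R}^n)$. Then there exist a set $E\subset\mathbb{R}^n$ which is $(p,s)$-thin at infinity and a number $K_{u^*}\in\mathbb{R}$ such that $$\lim_{x\to\infty,\ x\notin E}u^*(x)=K_{u^*},$$ i.e. for every $\varepsilon>0$ there is $R>0$ such that $|u^*(x)-K_{u^*}|<\varepsilon$ for all $x\in\mathbb{R}^n\setminus E$ with $|x|>R$.
   Context: For a measurable $u:\mathbb{R}^n\to\mathbb{R}$, set $[u]_{W^{s,p}_q(\mathbb{R}^n)}=\Big(\int_{\mathbb{R}^n}\Big(\int_{\mathbb{R}^n}\frac{|u(x)-u(y)|^q}{|x-y|^{n+sq}}\,dy\Big)^{p/q}dx\Big)^{1/p}$. A cube in $\mathbb{R}^n$ is a set $Q=[a_1,b_1)\times\cdots\times[a_n,b_n)$ with $b_1-a_1=\cdots=b_n-a_n>0$. For measurable a.e. finite $u$ and a measurable set $E$ of finite positive measure, the median is $m_u(E)=\sup\{M\in\mathbb{R}: |\{x\in E: u(x)<M\}|\le |E|/2\}$, where $|\cdot|$ is Lebesgue measure. The precise representative of $u$ is $u^*(x)=\limsup_{|Q|\to0,\ x\in Q}m_u(Q)=\inf_{\delta>0}\sup\{m_u(Q): Q \text{ a cube},\ x\in Q,\ |Q|<\delta\}$ (an extended real value), for every $x\in\mathbb{R}^n$; one has $u^*=u$ a.e. The space $\dot{W}^{s,p}_q(\mathbb{R}^n)$ is the collection of all precise representatives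 $u^*$ of measurable functions $u:\mathbb{R}^n\to\mathbb{R}$ with $[u]_{W^{s,p}_q(\mathbb{R}^n)}<\infty$. For $\lambda\in(0,\infty)$ the Hausdorff content is $\mathcal{H}^\lambda_\infty(A)=\inf\{\sum_{j}\operatorname{diam}(B_j)^\lambda: A\subset\bigcup_j B_j\}$ over countable covers. A set $E\subset\mathbb{R}^n$ is $(p,s)$-thin at infinity if $\lim_{m\to\infty}\mathcal{H}^\lambda_\infty(E\cap B(0,m)^c)=0$ for every $\lambda\in(0,\infty)$ with $\lambda>n-sp$. *)

theory Defs
  imports "HOL-Analysis.Analysis"
begin

text \<open>Real powers of values in \<open>[0, \<infinity>]\<close>, for positive exponents only.\<close>

definition ennreal_powr :: "ennreal \<Rightarrow> real \<Rightarrow> ennreal" where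
  "ennreal_powr x a = (if x = \<infinity> then \<infinity> else ennreal (enn2real x powr a))"

text \<open>At \<open>y = x\<close> the integrand is \<open>0 / 0 = 0\<close>; this affects only a null set of \<open>y\<close>.\<close>

definition W_seminorm :: "real \<Rightarrow> real \<Rightarrow> real \<Rightarrow> (real^'n \<Rightarrow> real) \<Rightarrow> ennreal" where
  "W_seminorm s p q u =
     ennreal_powr
       (\<integral>\<^sup>+ x. ennreal_powr
          (\<integral>\<^sup>+ y. ennreal (\<bar>u x - u y\<bar> powr q / norm (x - y) powr (real CARD('n) + s * q))
             \<partial>lebesgue) (p / q) \<partial>lebesgue) (1 / p)"

definition cubes :: "(real^'n) set set" where
  "cubes = {{x. \<forall>i. a $ i \<le> x $ i \<and> x $ i < b $ i} | a b. \<exists>h>0. \<forall>i. b $ i - a $ i = h}"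

text \<open>Meaningful for \<open>E\<close> of finite positive measure: the set under the supremum is then
  nonempty and bounded above, because \<open>u\<close> is finite everywhere.\<close>

definition median :: "(real^'n \<Rightarrow> real) \<Rightarrow> (real^'n) set \<Rightarrow> real" where
  "median u E = Sup {M. measure lebesgue {x \<in> E. u x < M} \<le> measure lebesgue E / 2}"

definition precise_rep :: "(real^'n \<Rightarrow> real) \<Rightarrow> real^'n \<Rightarrow> ereal" where
  "precise_rep u x =
     (INF \<delta>\<in>{0<..}. SUP Q\<in>{Q \<in> cubes. x \<in> Q \<and> measure lebesgue Q < \<delta>}. ereal (median u Q))"

definition W_dot :: "real \<Rightarrow> real \<Rightarrow> real \<Rightarrow> (real^'n \<Rightarrow> ereal) set" where
  "W_dot s p q = {precise_rep u | u. u \<in> borel_measurable lebesgue \<and> W_seminorm s p q u < \<infinity>}"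

text \<open>The covering sets are arbitrary bounded sets. Covers using an unbounded set have
  infinite sum and do not affect the infimum, but \<^const>\<open>diameter\<close> is unspecified on unbounded
  sets, so they are excluded. Finite covers are included by padding with empty sets, of
  diameter 0.\<close>

definition hausdorff_content :: "real \<Rightarrow> (real^'n) set \<Rightarrow> ennreal" where
  "hausdorff_content l A =
     Inf {(\<Sum>j. ennreal (diameter (B j) powr l)) | B :: nat \<Rightarrow> (real^'n) set.
            (\<forall>j. bounded (B j)) \<and> A \<subseteq> (\<Union>j. B j)}"

definition thin_at_infinity :: "real \<Rightarrow> real \<Rightarrow> (real^'n) set \<Rightarrow> bool" where
  "thin_at_infinity p s E \<longleftrightarrow>
     (\<forall>l>0. l > real CARD('n) - s * p \<longrightarrow>
        (\<lambda>m::nat. hausdorff_content l (E \<inter> - ball 0 (real m))) \<longlonglongrightarrow> 0)"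

end

theory Submission
  imports Defs "HOL-Real_Asymp.Real_Asymp"
begin

text \<open>
  The function is compared with its medians on cubes. Let \<open>G x\<close> be the inner integral of the seminorm and
  \<open>\<nu>\<close> the measure with density \<open>G powr (p / q)\<close>, which is finite by assumption. By Chebyshev's
  inequality \<open>u z\<close> is close to the median of \<open>u\<close> on any cube near \<open>z\<close> whose side is comparable to the
  distance, as soon as \<open>G z\<close> is small. A cube \<open>P\<close> of side \<open>h\<close> with little \<open>\<nu>\<close>-mass contains such a
  point \<open>z\<close>, which then ties together the medians of \<open>P\<close> and of all neighbouring cubes of
  similar side: they differ by at most a constant times
  \<open>(\<nu> P * h powr (s * p - n)) powr (1 / p)\<close> (\<open>cube_oscillation\<close>).

  Chaining this estimate over grid cells of dyadic sides leads to the theorem. Since \<open>s * p < n\<close> and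
  \<open>\<nu>\<close> is finite, the increments decay geometrically for large sides, so the medians on large cells converge to a
  number \<open>K\<close> that does not depend on the base point (\<open>coarse_limit\<close>). Moreover the median on the
  unit cell at \<open>x\<close> tends to \<open>K\<close> as \<open>x\<close> tends to infinity, because the cells at \<open>x\<close> of each
  given side lose their mass (\<open>coarse_close\<close>, \<open>coarse_far\<close>).

  For sides \<open>h = (1/2)^i\<close> the chain can diverge only at points where \<open>\<nu>\<close> concentrates, roughly where
  \<open>\<nu> P\<close> exceeds \<open>h powr (n - s * p)\<close> for small cells \<open>P\<close>. To obtain an exceptional set with
  increments tending to 0 off it, \<open>\<nu>\<close> is first multiplied by a weight that
  tends to infinity while the total mass stays finite (\<open>weighted_measure\<close>), and the threshold is lowered by a power
  of \<open>Suc i\<close> so that the increments are summable. Counting the cells above the threshold bounds the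
  Hausdorff content of the part of the exceptional set outside a ball by the weighted mass far out, for
  every exponent greater than \<open>n - s * p\<close> (\<open>bad_points_content\<close>).

  Off the exceptional set all cubes of side at most 1 containing \<open>x\<close> thus have median close to \<open>K\<close>
  (\<open>limit_off_thin_set\<close>), and the precise representative is an upper limit of such medians.
\<close>

section \<open>Medians and the slice energy\<close>

text \<open>A median ignores a set of less than half the measure: the values of \<open>u\<close> on the remaining
  majority all lie within \<open>t\<close> of \<open>c\<close>, and so does the median.\<close>

lemma median_within:
  fixes u :: "real^'n \<Rightarrow> real" and A :: "(real^'n) set"
  assumes u: "u \<in> borel_measurable borel" and A: "A \<in> sets borel" "emeasure lborel A < \<infinity>"
    and few: "measure lborel {y \<in> A. t \<le> \<bar>c - u y\<bar>} < measure lborel A / 2"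
  shows "\<bar>c - median u A\<bar> \<le> t"
proof -
  define S where "S = {y \<in> A. t \<le> \<bar>c - u y\<bar>}"
  define X where "X = {M. measure lebesgue {x \<in> A. u x < M} \<le> measure lebesgue A / 2}"
  have fin: "B \<in> fmeasurable lborel" if "B \<in> sets borel" "B \<subseteq> A" for B
    using that A emeasure_mono[of B A lborel] by (auto simp: fmeasurable_def intro: le_less_trans)
  have S: "S \<in> sets borel" unfolding S_def using u A by measurable
  have sub: "{x \<in> A. u x < M} \<in> sets borel" for M using u A by measurable
  have leb: "measure lebesgue {x \<in> A. u x < M} = measure lborel {x \<in> A. u x < M}" for M
    using sub by simp
  have lebA: "measure lebesgue A = measure lborel A" using A by simp
  have low: "c - t \<in> X"
  proof -
    have "measure lborel {x \<in> A. u x < c - t} \<le> measure lborel S"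
      using sub by (intro measure_mono_fmeasurable) (auto simp: S_def intro!: fin S[unfolded S_def])
    then show ?thesis using few unfolding X_def leb lebA S_def by auto
  qed
  have up: "M \<le> c + t" if "M \<in> X" for M
  proof (rule ccontr)
    assume "\<not> M \<le> c + t"
    then have "A - S \<subseteq> {x \<in> A. u x < M}" by (auto simp: S_def)
    then have "measure lborel (A - S) \<le> measure lborel {x \<in> A. u x < M}"
      using sub A S by (intro measure_mono_fmeasurable) (auto intro!: fin)
    moreover have "measure lborel (A - S) = measure lborel A - measure lborel S"
      using A S by (intro measurable_measure_Diff) (auto intro!: fin simp: S_def)
    ultimately show False using that few unfolding X_def leb lebA S_def by auto
  qed
  have "c - t \<le> Sup X" using low up by (intro cSup_upper) (auto simp: bdd_above_def)
  moreover have "Sup X \<le> c + t" using low up by (intro cSup_least) auto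
  ultimately show ?thesis unfolding median_def X_def[symmetric] by auto
qed

text \<open>The inner integral of the seminorm. Its power \<open>1/q\<close> plays the part of a fractional
  gradient of \<open>u\<close>: by \<open>median_near_value\<close>, \<open>\<bar>u z - median u A\<bar>\<close> is at most a
  constant times \<open>(diameter A) powr s\<close> times this gradient at \<open>z\<close>, when \<open>A\<close> is a cube
  containing \<open>z\<close>.\<close>

definition slice_energy :: "real \<Rightarrow> real \<Rightarrow> (real^'n \<Rightarrow> real) \<Rightarrow> real^'n \<Rightarrow> ennreal" where
  "slice_energy s q u x =
     (\<integral>\<^sup>+ y. ennreal (\<bar>u x - u y\<bar> powr q / norm (x - y) powr (real CARD('n) + s * q)) \<partial>lborel)"

lemma slice_energy_measurable [measurable]:
  fixes u :: "real^'n \<Rightarrow> real"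
  assumes [measurable]: "u \<in> borel_measurable borel"
  shows "slice_energy s q u \<in> borel_measurable borel"
proof -
  have "slice_energy s q u \<in> borel_measurable lborel"
    unfolding slice_energy_def
    by (rule sigma_finite_measure.borel_measurable_nn_integral[OF sigma_finite_lborel]) measurable
  then show ?thesis by simp
qed

text \<open>Chebyshev's inequality on \<open>A\<close>: inside the ball of radius \<open>D\<close> about \<open>z\<close> the kernel is at least
  \<open>D powr - (n + s * q)\<close>, so a small slice energy at \<open>z\<close> leaves less than half of \<open>A\<close> for points
  whose value differs from \<open>u z\<close> by \<open>t\<close> or more.\<close>

lemma median_near_value:
  fixes u :: "real^'n \<Rightarrow> real" and A :: "(real^'n) set"
  assumes u[measurable]: "u \<in> borel_measurable borel"
    and A[measurable]: "A \<in> sets borel" and Afin: "emeasure lborel A < \<infinity>"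
    and "0 < s" "0 < q" "0 < t"
    and D: "\<And>y. y \<in> A \<Longrightarrow> norm (z - y) \<le> D"
    and small: "slice_energy s q u z * ennreal (D powr (real CARD('n) + s * q))
      < ennreal (t powr q * measure lborel A / 2)"
  shows "\<bar>u z - median u A\<bar> \<le> t"
proof (rule median_within[OF u A Afin])
  define k where "k = real CARD('n) + s * q"
  have k: "0 \<le> k" using assms by (simp add: k_def)
  define S where "S = {y \<in> A. t \<le> \<bar>u z - u y\<bar>}"
  have S[measurable]: "S \<in> sets borel" unfolding S_def by measurable
  have Sfin: "emeasure lborel S < \<infinity>"
    using emeasure_mono[of S A lborel] Afin by (auto simp: S_def intro: le_less_trans)
  have "ennreal (t powr q) * emeasure lborel S
      = (\<integral>\<^sup>+ y. ennreal (t powr q) * indicator S y \<partial>lborel)"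
    by (simp add: nn_integral_cmult_indicator)
  also have "\<dots> \<le> (\<integral>\<^sup>+ y. ennreal (\<bar>u z - u y\<bar> powr q / norm (z - y) powr k)
      * ennreal (D powr k) \<partial>lborel)"
  proof (rule nn_integral_mono)
    fix y
    show "ennreal (t powr q) * indicator S y
      \<le> ennreal (\<bar>u z - u y\<bar> powr q / norm (z - y) powr k) * ennreal (D powr k)"
    proof (cases "y \<in> S")
      case True
      then have "z \<noteq> y" using \<open>0 < t\<close> by (auto simp: S_def)
      then have n: "0 < norm (z - y)" "norm (z - y) \<le> D" using D True by (auto simp: S_def)
      have "t powr q \<le> \<bar>u z - u y\<bar> powr q"
        using True \<open>0 < t\<close> \<open>0 < q\<close> by (auto simp: S_def intro!: powr_mono2)
      also have "\<dots> \<le> \<bar>u z - u y\<bar> powr q / norm (z - y) powr k * D powr k"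
        using n k powr_mono2[of k "norm (z - y)" D]
        by (simp add: field_simps mult_right_mono)
      finally show ?thesis using True by (simp add: ennreal_mult[symmetric])
    qed simp
  qed
  also have "\<dots> = slice_energy s q u z * ennreal (D powr k)"
    unfolding slice_energy_def k_def by (rule nn_integral_multc) measurable
  also have "\<dots> < ennreal (t powr q * measure lborel A / 2)" using small by (simp add: k_def)
  finally have "ennreal (t powr q * measure lborel S) < ennreal (t powr q * measure lborel A / 2)"
    using Sfin by (simp add: emeasure_eq_ennreal_measure ennreal_mult)
  then have "t powr q * measure lborel S < t powr q * (measure lborel A / 2)"
    by (subst (asm) ennreal_less_iff) auto
  then show "measure lborel {y \<in> A. t \<le> \<bar>u z - u y\<bar>} < measure lborel A / 2"
    using \<open>0 < t\<close> by (simp add: S_def)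
qed

section \<open>Half-open cubes and grid cells\<close>

definition cube :: "real^'n \<Rightarrow> real \<Rightarrow> (real^'n) set" where
  "cube a h = {x. \<forall>i. a $ i \<le> x $ i \<and> x $ i < a $ i + h}"

lemma cubes_eq: "cubes = {cube a h | a h :: real. 0 < h}"
proof safe
  fix Q :: "(real^'n) set" assume "Q \<in> cubes"
  then obtain a b h where Q: "Q = {x. \<forall>i. a $ i \<le> x $ i \<and> x $ i < b $ i}" "h > 0"
    "\<And>i. b $ i - a $ i = h" unfolding cubes_def by blast
  have "b $ i = a $ i + h" for i using Q(3)[of i] by simp
  then have "Q = cube a h" using Q(1) by (simp add: cube_def)
  then show "\<exists>a h. Q = cube a h \<and> 0 < h" using Q(2) by blast
next
  fix a :: "real^'n" and h :: real assume "0 < h"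
  then show "cube a h \<in> cubes" unfolding cubes_def cube_def
    by (intro CollectI exI[of _ a] exI[of _ "\<chi> i. a $ i + h"]) auto
qed

lemma cube_borel [measurable]: "cube a h \<in> sets borel"
  unfolding cube_def by measurable

lemma emeasure_cube:
  assumes "0 < h"
  shows "emeasure lborel (cube (a :: real^'n) h) = ennreal (h ^ CARD('n))"
proof (rule antisym)
  let ?b = "\<chi> i. a $ i + h"
  have "a \<in> cbox a ?b" using assms by (simp add: mem_box_cart)
  then have ne: "cbox a ?b \<noteq> {}" by blast
  have "emeasure lborel (cube a h) \<le> emeasure lborel (cbox a ?b)"
    by (rule emeasure_mono) (auto simp: cube_def mem_box_cart less_imp_le)
  also have c: "emeasure lborel (cbox a ?b) = ennreal (measure lborel (cbox a ?b))"
    by (rule emeasure_eq_ennreal_measure) (use emeasure_lborel_cbox_finite[of a ?b] in auto)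
  also have d: "measure lborel (cbox a ?b) = h ^ CARD('n)"
    using ne by (simp add: content_cbox_cart)
  finally show "emeasure lborel (cube a h) \<le> ennreal (h ^ CARD('n))" .
  have "emeasure lborel (box a ?b) = emeasure lborel (cbox a ?b)"
    by (simp add: emeasure_lborel_box_eq emeasure_lborel_cbox_eq)
  moreover have "emeasure lborel (box a ?b) \<le> emeasure lborel (cube a h)"
    by (rule emeasure_mono) (auto simp: cube_def mem_box_cart less_imp_le)
  ultimately show "ennreal (h ^ CARD('n)) \<le> emeasure lborel (cube a h)" using c d by simp
qed

lemma measure_cube:
  "0 < h \<Longrightarrow> measure lborel (cube (a :: real^'n) h) = h ^ CARD('n)"
  by (simp add: measure_def emeasure_cube)

lemma norm_le_card_times:
  fixes x :: "real^'n"
  assumes "\<And>i. \<bar>x $ i\<bar> \<le> M"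
  shows "norm x \<le> real CARD('n) * M"
proof -
  have "norm x \<le> (\<Sum>i\<in>UNIV. \<bar>x $ i\<bar>)" by (rule norm_le_l1_cart)
  also have "\<dots> \<le> (\<Sum>i\<in>(UNIV::'n set). M)" by (intro sum_mono assms)
  finally show ?thesis by simp
qed

text \<open>The cell containing \<open>x\<close> of the grid of side \<open>h\<close> with a vertex at the origin.\<close>

definition grid_cell :: "real \<Rightarrow> real^'n \<Rightarrow> (real^'n) set" where
  "grid_cell h x = cube (\<chi> i. h * of_int \<lfloor>x $ i / h\<rfloor>) h"

lemma floor_times_bounds:
  fixes h y :: real assumes "0 < h"
  shows "h * of_int \<lfloor>y / h\<rfloor> \<le> y" "y < h * of_int \<lfloor>y / h\<rfloor> + h"
proof -
  show "h * of_int \<lfloor>y / h\<rfloor> \<le> y"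
    using mult_left_mono[OF of_int_floor_le[of "y / h"], of h] assms by simp
  have "y / h < of_int \<lfloor>y / h\<rfloor> + 1" by linarith
  then show "y < h * of_int \<lfloor>y / h\<rfloor> + h"
    using assms by (simp add: pos_divide_less_eq algebra_simps)
qed

lemma grid_cell_self: "0 < h \<Longrightarrow> x \<in> grid_cell h x"
  by (simp add: grid_cell_def cube_def floor_times_bounds)

lemma norm_diff_cube:
  fixes x y :: "real^'n"
  assumes "x \<in> cube a h" "y \<in> cube a h"
  shows "norm (x - y) \<le> real CARD('n) * h"
proof (rule norm_le_card_times)
  fix i show "\<bar>(x - y) $ i\<bar> \<le> h"
    using assms by (auto simp: cube_def dest!: spec[of _ i])
qed

lemma grid_cell_subset_far:
  fixes x :: "real^'n"
  assumes "0 < h" "R + real CARD('n) * h \<le> norm x"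
  shows "grid_cell h x \<subseteq> - ball 0 R"
proof
  fix y assume "y \<in> grid_cell h x"
  then have "norm (x - y) \<le> real CARD('n) * h"
    using grid_cell_self[OF assms(1), of x] norm_diff_cube unfolding grid_cell_def by blast
  then show "y \<in> - ball 0 R" using assms(2) norm_triangle_ineq2[of x y] by auto
qed

section \<open>Oscillation of medians between cubes of one scale\<close>

text \<open>The outer integral of the seminorm as a measure, so that the seminorm is finite exactly when the
  total mass is.\<close>

definition energy :: "real \<Rightarrow> real \<Rightarrow> real \<Rightarrow> (real^'n \<Rightarrow> real) \<Rightarrow> (real^'n) measure" where
  "energy s p q u = density lborel (\<lambda>x. ennreal_powr (slice_energy s q u x) (p / q))"

lemma ennreal_powr_measurable [measurable]:
  assumes [measurable]: "f \<in> borel_measurable M"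
  shows "(\<lambda>x. ennreal_powr (f x) a) \<in> borel_measurable M"
  unfolding ennreal_powr_def by measurable

lemma ennreal_powr_mono:
  assumes "ennreal r \<le> x" "0 \<le> r" "0 \<le> a"
  shows "ennreal (r powr a) \<le> ennreal_powr x a"
proof (cases x rule: ennreal_cases)
  case (real y)
  then show ?thesis using assms
    by (auto simp: ennreal_powr_def intro!: powr_mono2 ennreal_leI)
qed (simp add: ennreal_powr_def)

lemma sets_energy [simp, measurable_cong]: "sets (energy s p q u) = sets borel"
  by (simp add: energy_def)

text \<open>If the cube of side \<open>h\<close> carries less energy than \<open>c * t powr p * h powr (n - s * p)\<close>, it must
  contain a point \<open>z\<close> of small slice energy, because otherwise integrating the lower bound over the
  cube gives too much. The value \<open>u z\<close> is then within \<open>t\<close> of the medians of all cubes of comparable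
  side nearby, including cubes that do not contain \<open>z\<close>. Using one point \<open>z\<close>, not a mean
  value, makes the argument work for every positive \<open>p\<close> and \<open>q\<close>; allowing \<open>z\<close> outside the second
  cube lets the energy be measured on grid cells, which are disjoint.\<close>

lemma cube_oscillation:
  fixes s p q :: real
  assumes "0 < s" "0 < p" "0 < q"
  obtains c where "0 < c"
    "\<And>(u::real^'n \<Rightarrow> real) a b h r t.
       \<lbrakk>u \<in> borel_measurable borel; 0 < h; h / 2 \<le> r; r \<le> h; \<And>i. \<bar>a $ i - b $ i\<bar> \<le> 2 * h; 0 < t;
        emeasure (energy s p q u) (cube a h) < ennreal (c * t powr p * h powr (real CARD('n) - s * p))\<rbrakk>
       \<Longrightarrow> \<bar>median u (cube a h) - median u (cube b r)\<bar> \<le> 2 * t"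
proof -
  let ?n = "real CARD('n)"
  \<comment> \<open>Two points of the cubes are at distance at most \<open>4 * n * h\<close>, and each cube has volume at least
    \<open>(h / 2) ^ n\<close>; \<open>w\<close> collects what these bounds contribute besides powers of \<open>t\<close> and \<open>h\<close>.\<close>
  define w where "w = (1/2) powr ?n / 2 / (4 * ?n) powr (?n + s * q)"
  define c where "c = w powr (p / q)"
  have n: "0 < ?n" by simp
  have w: "0 < w" using n by (simp add: w_def)
  then have "0 < c" by (simp add: c_def)
  moreover have "\<bar>median u (cube a h) - median u (cube b r)\<bar> \<le> 2 * t"
    if u[measurable]: "u \<in> borel_measurable borel" and h: "0 < h" "h / 2 \<le> r" "r \<le> h"
      and ab: "\<And>i. \<bar>a $ i - b $ i\<bar> \<le> 2 * h" and "0 < t"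
      and small: "emeasure (energy s p q u) (cube a h)
        < ennreal (c * t powr p * h powr (?n - s * p))"
    for u :: "real^'n \<Rightarrow> real" and a b h r t
  proof -
    \<comment> \<open>\<open>g\<close> is the largest slice energy for which the Chebyshev estimate still applies.\<close>
    define D where "D = 4 * ?n * h"
    define \<kappa> where "\<kappa> = ?n + s * q"
    define m where "m = t powr q * (h / 2) powr ?n / 2"
    define g where "g = m / D powr \<kappa>"
    have D0: "0 < D" using n h by (simp add: D_def)
    have g0: "0 < g" using D0 h \<open>0 < t\<close> by (simp add: g_def m_def)
    have gpow: "g powr (p / q) * h powr ?n = c * t powr p * h powr (?n - s * p)"
    proof -
      have "g = t powr q * w * (h powr ?n / h powr \<kappa>)"
        using h n by (simp add: g_def m_def D_def w_def \<kappa>_def powr_mult powr_divide)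
      also have "h powr ?n / h powr \<kappa> = h powr (- (s * q))"
        by (simp add: \<kappa>_def powr_diff[symmetric])
      finally have "g powr (p / q) = (t powr q) powr (p / q) * c * (h powr (- (s * q))) powr (p / q)"
        using w by (simp add: powr_mult c_def)
      also have "\<dots> = t powr p * c * h powr (- (s * p))"
        using assms by (simp add: powr_powr)
      finally have "g powr (p / q) * h powr ?n = t powr p * c * (h powr (- (s * p)) * h powr ?n)"
        by (simp only: mult.assoc)
      also have "h powr (- (s * p)) * h powr ?n = h powr (?n - s * p)"
        by (simp add: powr_add[symmetric])
      finally show ?thesis by simp
    qed
    have "\<exists>z\<in>cube a h. slice_energy s q u z < ennreal g"
    proof (rule ccontr)
      assume "\<not> ?thesis"
      then have ge: "ennreal g \<le> slice_energy s q u z" if "z \<in> cube a h" for z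
        using that by (auto simp: not_less)
      have "ennreal (c * t powr p * h powr (?n - s * p))
          = ennreal (g powr (p / q)) * emeasure lborel (cube a h)"
        using h by (simp add: gpow[symmetric] emeasure_cube ennreal_mult powr_realpow)
      also have "\<dots> = (\<integral>\<^sup>+ x. ennreal (g powr (p / q)) * indicator (cube a h) x \<partial>lborel)"
        by (simp add: nn_integral_cmult_indicator)
      also have "\<dots> \<le> (\<integral>\<^sup>+ x. ennreal_powr (slice_energy s q u x) (p / q) * indicator (cube a h) x \<partial>lborel)"
        using assms g0 by (intro nn_integral_mono)
          (auto split: split_indicator intro!: ennreal_powr_mono ge)
      also have "\<dots> = emeasure (energy s p q u) (cube a h)"
        unfolding energy_def by (subst emeasure_density) measurable
      finally show False using small by simp
    qed
    then obtain z where z: "z \<in> cube a h" "slice_energy s q u z < ennreal g" by blast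
    have "slice_energy s q u z * ennreal (D powr \<kappa>) < ennreal g * ennreal (D powr \<kappa>)"
      using z D0 by (intro ennreal_mult_strict_right_mono) auto
    also have "\<dots> = ennreal m"
      using D0 g0 by (simp add: ennreal_mult[symmetric] g_def)
    finally have less: "slice_energy s q u z * ennreal (D powr \<kappa>) < ennreal m" .
    have near: "\<bar>u z - median u (cube e k)\<bar> \<le> t"
      if "h / 2 \<le> k" "k \<le> h" "\<And>i. \<bar>a $ i - e $ i\<bar> \<le> 2 * h" for e k
    proof (rule median_near_value[OF u _ _ \<open>0 < s\<close> \<open>0 < q\<close> \<open>0 < t\<close>])
      have k: "0 < k" using that h by simp
      show "emeasure lborel (cube e k) < \<infinity>" using k by (simp add: emeasure_cube)
      show "norm (z - y) \<le> D" if y: "y \<in> cube e k" for y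
      proof -
        have "norm (z - y) \<le> ?n * (4 * h)"
        proof (rule norm_le_card_times)
          fix i
          show "\<bar>(z - y) $ i\<bar> \<le> 4 * h"
            using z(1) y \<open>k \<le> h\<close> \<open>\<bar>a $ i - e $ i\<bar> \<le> 2 * h\<close>
            by (auto simp: cube_def dest!: spec[of _ i])
        qed
        then show ?thesis by (simp add: D_def mult.commute mult.left_commute)
      qed
      have "(h / 2) ^ CARD('n) \<le> k ^ CARD('n)" using that h by (intro power_mono) auto
      then have "(h / 2) powr ?n \<le> k ^ CARD('n)" using h by (simp add: powr_realpow)
      then have "m \<le> t powr q * measure lborel (cube e k) / 2"
        using k by (simp add: m_def measure_cube mult_left_mono)
      then show "slice_energy s q u z * ennreal (D powr (?n + s * q))
          < ennreal (t powr q * measure lborel (cube e k) / 2)"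
        using less unfolding \<kappa>_def by (meson ennreal_leI less_le_trans)
    qed simp
    have "\<bar>u z - median u (cube a h)\<bar> \<le> t" using h by (intro near) auto
    moreover have "\<bar>u z - median u (cube b r)\<bar> \<le> t" using h ab by (intro near) auto
    ultimately show ?thesis by linarith
  qed
  ultimately show thesis by (rule that)
qed


section \<open>Finite measures far from the origin\<close>

lemma finite_measure_tail:
  fixes \<nu> :: "'a::real_normed_vector measure"
  assumes "sets \<nu> = sets borel" "emeasure \<nu> UNIV < \<infinity>"
  shows "(\<lambda>k. emeasure \<nu> (- ball 0 (real k))) \<longlonglongrightarrow> 0"
proof -
  have "(\<lambda>k. emeasure \<nu> (- ball 0 (real k))) \<longlonglongrightarrow> emeasure \<nu> (\<Inter>k. - ball 0 (real k))"
  proof (rule Lim_emeasure_decseq)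
    show "range (\<lambda>k. - ball (0::'a) (real k)) \<subseteq> sets \<nu>" unfolding assms(1) by (intro image_subsetI borel_closed closed_Compl open_ball)
    show "decseq (\<lambda>k. - ball (0::'a) (real k))"
      by (intro antimonoI) (simp add: subset_ball)
    fix k
    have "emeasure \<nu> (- ball 0 (real k)) \<le> emeasure \<nu> UNIV"
      using assms(1) by (intro emeasure_mono) auto
    then show "emeasure \<nu> (- ball 0 (real k)) \<noteq> \<infinity>" using assms(2) by auto
  qed
  also have "(\<Inter>k. - ball (0::'a) (real k)) = {}"
  proof -
    have "\<exists>k. x \<in> ball 0 (real k)" for x :: 'a
      using reals_Archimedean2[of "norm x"] by simp
    then show ?thesis by blast
  qed
  finally show ?thesis by simp
qed

text \<open>A finite measure can be multiplied by a weight that tends to infinity at infinity and stay finite.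
  This gain allows one exceptional set to serve all tolerances: a smallness condition on the
  weighted measure with a fixed threshold becomes one on \<open>\<nu>\<close> with thresholds tending to 0.\<close>

lemma weighted_measure:
  fixes \<nu> :: "'a::real_normed_vector measure"
  assumes S: "sets \<nu> = sets borel" and fin: "emeasure \<nu> UNIV < \<infinity>"
  obtains \<nu>' where "sets \<nu>' = sets borel" "emeasure \<nu>' UNIV < \<infinity>"
    "\<And>N::nat. \<exists>R. \<forall>A\<in>sets borel. A \<subseteq> - ball 0 R \<longrightarrow> of_nat N * emeasure \<nu> A \<le> emeasure \<nu>' A"
proof -
  have "\<exists>r. emeasure \<nu> (- ball 0 (real r)) < ennreal ((1/2)^k)" for k
    using order_tendstoD(2)[OF finite_measure_tail[OF assms], of "ennreal ((1/2)^k)"]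
    by (auto simp: eventually_sequentially)
  then obtain r :: "nat \<Rightarrow> nat" where r: "\<And>k. emeasure \<nu> (- ball 0 (real (r k))) < ennreal ((1/2)^k)"
    by metis
  \<comment> \<open>The weight counts the balls that \<open>x\<close> lies outside of; the tails are summable by choice of \<open>r\<close>.\<close>
  define w :: "'a \<Rightarrow> ennreal" where "w x = (\<Sum>k. indicator (- ball 0 (real (r k))) x)" for x
  have w[measurable]: "w \<in> borel_measurable \<nu>"
    unfolding w_def measurable_cong_sets[OF S refl] by measurable
  have sets: "- ball 0 (real (r k)) \<in> sets \<nu>" for k using S by simp
  show thesis
  proof (rule that[of "density \<nu> w"])
    show "sets (density \<nu> w) = sets borel" using S by simp
    have sp: "space \<nu> = UNIV" using sets_eq_imp_space_eq[OF S] by simp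
    have "emeasure (density \<nu> w) UNIV = (\<integral>\<^sup>+x. w x \<partial>\<nu>)"
      using sets.top[of \<nu>] sp by (subst emeasure_density[OF w]) auto
    also have "\<dots> = (\<Sum>k. emeasure \<nu> (- ball 0 (real (r k))))"
      unfolding w_def using sets by (subst nn_integral_suminf) auto
    also have "\<dots> \<le> (\<Sum>k. ennreal ((1/2)^k))"
      using r by (intro suminf_le) (auto intro: less_imp_le)
    also have "\<dots> = ennreal (\<Sum>k. (1/2)^k)"
      by (rule suminf_ennreal2) (auto intro: summable_geometric)
    finally show "emeasure (density \<nu> w) UNIV < \<infinity>" by (auto intro: le_less_trans)
    fix N :: nat
    define R where "R = real (\<Sum>k<N. r k)"
    have "of_nat N * emeasure \<nu> A \<le> emeasure (density \<nu> w) A"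
      if A: "A \<in> sets borel" "A \<subseteq> - ball 0 R" for A
    proof -
      have As: "A \<in> sets \<nu>" using A S by simp
      have ge: "of_nat N \<le> w x" if "x \<in> A" for x
      proof -
        have "x \<in> - ball 0 (real (r k))" if "k < N" for k
        proof -
          have "r k \<le> (\<Sum>k<N. r k)" using that by (intro member_le_sum) auto
          then have "real (r k) \<le> R" unfolding R_def by (simp only: of_nat_le_iff)
          then show ?thesis using \<open>x \<in> A\<close> A(2) by auto
        qed
        then have "(\<Sum>k<N. indicator (- ball 0 (real (r k))) x) = (\<Sum>k<N. 1 :: ennreal)"
          by (intro sum.cong) auto
        moreover have "(\<Sum>k<N. indicator (- ball 0 (real (r k))) x) \<le> w x"
          unfolding w_def by (intro sum_le_suminf) auto
        ultimately show ?thesis by simp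
      qed
      have "of_nat N * emeasure \<nu> A = (\<integral>\<^sup>+x. of_nat N * indicator A x \<partial>\<nu>)"
        using As by (simp add: nn_integral_cmult_indicator)
      also have "\<dots> \<le> (\<integral>\<^sup>+x. w x * indicator A x \<partial>\<nu>)"
        by (intro nn_integral_mono) (auto split: split_indicator intro: ge)
      also have "\<dots> = emeasure (density \<nu> w) A"
        using As by (simp add: emeasure_density)
      finally show ?thesis .
    qed
    then show "\<exists>R. \<forall>A\<in>sets borel. A \<subseteq> - ball 0 R \<longrightarrow> of_nat N * emeasure \<nu> A \<le> emeasure (density \<nu> w) A"
      by blast
  qed
qed

section \<open>Points at which a measure concentrates\<close>

text \<open>The threshold for a cell of side \<open>h = (1/2)^i\<close> is \<open>h powr d\<close> up to a power of \<open>Suc i\<close>. The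
  factor \<open>real (Suc i) powr (- 2 * p)\<close> is the \<open>p\<close>-th power of the terms of a convergent series, which
  makes median increments summable at the other points. Being subexponential in \<open>i\<close>, it
  leaves the threshold above a multiple of \<open>h powr l\<close> for each \<open>l > d\<close>.\<close>

definition bad_points :: "real \<Rightarrow> real \<Rightarrow> (real^'n) measure \<Rightarrow> (real^'n) set" where
  "bad_points p d \<nu> =
     {x. \<exists>i::nat. ennreal (real (Suc i) powr (- 2 * p) * ((1/2)^i) powr d)
           \<le> emeasure \<nu> (grid_cell ((1/2)^i) x)}"

lemma summable_poly_geometric:
  fixes a \<delta> :: real assumes "0 < \<delta>"
  shows "summable (\<lambda>i. real (Suc i) powr a * ((1/2)^i) powr \<delta>)"
proof (rule summable_comparison_test_ev)
  let ?g = "\<lambda>i. ((1/2) powr (\<delta>/2)) ^ i"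
  define c where "c = ln 2 * (\<delta>/2)"
  have "0 < c" using assms by (simp add: c_def)
  then have "(\<lambda>i. real (Suc i) powr a * exp (- c * real i)) \<longlonglongrightarrow> 0"
    by real_asymp
  moreover have "exp (- c * real i) = (1/2) powr (real i * (\<delta>/2))" for i :: nat
    by (simp add: powr_def c_def ln_div algebra_simps)
  ultimately have "(\<lambda>i. real (Suc i) powr a * (1/2) powr (real i * (\<delta>/2))) \<longlonglongrightarrow> 0"
    by simp
  then have "eventually (\<lambda>i. real (Suc i) powr a * (1/2) powr (real i * (\<delta>/2)) < 1) sequentially"
    by (rule order_tendstoD) simp
  then show "eventually (\<lambda>i. norm (real (Suc i) powr a * ((1/2)^i) powr \<delta>) \<le> ?g i) sequentially"
  proof eventually_elim
    case (elim i)
    have h: "((1/2::real)^i) powr \<delta> = (1/2) powr (real i * (\<delta>/2)) * (1/2) powr (real i * (\<delta>/2))"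
      by (simp add: powr_realpow[symmetric] powr_powr powr_add[symmetric] mult.commute)
    have "real (Suc i) powr a * ((1/2)^i) powr \<delta> \<le> 1 * (1/2) powr (real i * (\<delta>/2))"
      unfolding h mult.assoc[symmetric] using elim by (intro mult_right_mono) auto
    also have "\<dots> = ?g i" by (simp add: powr_realpow[symmetric] powr_powr mult.commute)
    finally show ?case by simp
  qed
  show "summable ?g" using assms by (intro summable_geometric) (simp add: powr01_less_one)
qed

text \<open>Cover the set by all cells, of every level \<open>i\<close>, that reach the threshold. Cells of one level are
  disjoint, so the number of them far out is at most the mass far out over the threshold. The
  resulting sum over all levels converges since \<open>l > d\<close>, and it is proportional to the mass far
  out, which tends to 0.\<close>

lemma bad_points_content:
  fixes \<nu> :: "(real^'n) measure"
  assumes S: "sets \<nu> = sets borel" and fin: "emeasure \<nu> UNIV < \<infinity>"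
    and l: "0 < l" "d < l"
  shows "(\<lambda>m::nat. hausdorff_content l (bad_points p d \<nu> \<inter> - ball 0 (real m))) \<longlonglongrightarrow> 0"
proof -
  let ?n = "CARD('n)"
  define thr where "thr i = real (Suc i) powr (- 2 * p) * ((1/2)^i) powr d" for i :: nat
  have thr0: "0 < thr i" for i by (simp add: thr_def)
  define C where "C i = (real ?n * (1/2)^i) powr l / thr i" for i :: nat
  have C0: "0 \<le> C i" for i using thr0[of i] by (simp add: C_def)
  define cell where "cell i z = cube (\<chi> j. (1/2)^i * of_int (z $ j)) ((1/2)^i)"
    for i :: nat and z :: "int^'n"
  define e :: "nat \<Rightarrow> int^'n" where "e = from_nat_into UNIV"
  have "inj (\<lambda>k::int. (vec k :: int^'n))" by (auto simp: inj_def vec_eq_iff)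
  then have "infinite (UNIV :: (int^'n) set)"
    by (meson finite_subset infinite_UNIV_int finite_imageD subset_UNIV)
  then have e: "bij e" unfolding e_def by (intro bij_betw_from_nat_into) auto
  \<comment> \<open>A cell of side at most 1 that meets the complement of the ball of radius \<open>m\<close> lies in \<open>T m\<close>. The
    truncated subtraction makes \<open>T m\<close> the whole space for \<open>m < n\<close>.\<close>
  define T where "T m = - ball (0::real^'n) (real (m - ?n))" for m :: nat
  have content: "hausdorff_content l (bad_points p d \<nu> \<inter> - ball 0 (real m))
      \<le> (\<Sum>i. ennreal (C i)) * emeasure \<nu> (T m)" for m
  proof -
    define B where "B = (\<lambda>(i, k). if ennreal (thr i) \<le> emeasure \<nu> (cell i (e k)) \<and> cell i (e k) \<subseteq> T m
      then cell i (e k) else {})"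
    have bounded: "bounded (B ik)" for ik
    proof -
      have "bounded (cell i z)" for i z
      proof -
        have "cell i z \<subseteq> cbox (\<chi> j. (1/2)^i * of_int (z $ j)) (\<chi> j. (1/2)^i * of_int (z $ j) + (1/2)^i)"
          by (auto simp: cell_def cube_def mem_box_cart less_imp_le)
        then show ?thesis using bounded_cbox bounded_subset by blast
      qed
      then show ?thesis by (auto simp: B_def split: prod.split)
    qed
    have cover: "bad_points p d \<nu> \<inter> - ball 0 (real m) \<subseteq> (\<Union>j. B (prod_decode j))"
    proof
      fix x assume x: "x \<in> bad_points p d \<nu> \<inter> - ball 0 (real m)"
      then obtain i where i: "ennreal (thr i) \<le> emeasure \<nu> (grid_cell ((1/2)^i) x)"
        by (auto simp: bad_points_def thr_def)
      define z :: "int^'n" where "z = (\<chi> j. \<lfloor>x $ j / (1/2)^i\<rfloor>)"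
      obtain k where k: "z = e k" using bij_is_surj[OF e] by (metis surj_def)
      have cell: "grid_cell ((1/2)^i) x = cell i (e k)"
        by (simp add: grid_cell_def cell_def k[symmetric] z_def)
      have "grid_cell ((1/2)^i) x \<subseteq> T m"
      proof (cases "?n \<le> m")
        case True
        have "real ?n * (1/2)^i \<le> real ?n * 1"
          by (intro mult_left_mono power_le_one) auto
        moreover have "real m \<le> norm x" using x by auto
        ultimately have "real (m - ?n) + real ?n * (1/2)^i \<le> norm x"
          unfolding of_nat_diff[OF True] by linarith
        then show ?thesis unfolding T_def by (intro grid_cell_subset_far) auto
      qed (simp add: T_def)
      then have "cell i (e k) \<subseteq> T m" unfolding cell .
      then have "B (i, k) = cell i (e k)" using i by (simp add: B_def cell)
      moreover have "x \<in> cell i (e k)" unfolding cell[symmetric] by (rule grid_cell_self) simp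
      ultimately have "x \<in> B (prod_decode (prod_encode (i, k)))" by simp
      then show "x \<in> (\<Union>j. B (prod_decode j))" by blast
    qed
    have "hausdorff_content l (bad_points p d \<nu> \<inter> - ball 0 (real m))
        \<le> (\<Sum>j. ennreal (diameter (B (prod_decode j)) powr l))"
      unfolding hausdorff_content_def using bounded cover
      by (intro Inf_lower CollectI exI[of _ "\<lambda>j. B (prod_decode j)"]) auto
    also have "\<dots> = (\<Sum>i. \<Sum>k. ennreal (diameter (B (i, k)) powr l))"
      by (rule suminf_ennreal_2dimen[where f = "\<lambda>ik. ennreal (diameter (B ik) powr l)"]) (rule refl)
    also have "\<dots> \<le> (\<Sum>i. ennreal (C i) * emeasure \<nu> (T m))"
    proof (intro suminf_le summableI)
      fix i
      have "(\<Sum>k. ennreal (diameter (B (i, k)) powr l)) \<le> (\<Sum>k. ennreal (C i) * emeasure \<nu> (B (i, k)))"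
      proof (intro suminf_le summableI)
        fix k
        show "ennreal (diameter (B (i, k)) powr l) \<le> ennreal (C i) * emeasure \<nu> (B (i, k))"
        proof (cases "B (i, k) = {}")
          case False
          then have B: "B (i, k) = cell i (e k)" "ennreal (thr i) \<le> emeasure \<nu> (B (i, k))"
            by (auto simp: B_def split: if_splits)
          have "diameter (B (i, k)) \<le> real ?n * (1/2)^i"
            unfolding B(1) cell_def
            by (rule diameter_le) (auto intro: norm_diff_cube)
          then have "diameter (B (i, k)) powr l \<le> (real ?n * (1/2)^i) powr l"
            using l bounded diameter_ge_0 by (intro powr_mono2) auto
          then have "ennreal (diameter (B (i, k)) powr l) \<le> ennreal (C i * thr i)"
            using thr0[of i] by (intro ennreal_leI) (simp add: C_def)
          also have "\<dots> = ennreal (C i) * ennreal (thr i)"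
            using C0 thr0[of i] by (simp add: ennreal_mult)
          also have "\<dots> \<le> ennreal (C i) * emeasure \<nu> (B (i, k))"
            by (intro mult_left_mono B) auto
          finally show ?thesis .
        qed simp
      qed
      also have "\<dots> = ennreal (C i) * (\<Sum>k. emeasure \<nu> (B (i, k)))"
        by (simp add: ennreal_suminf_cmult)
      also have "(\<Sum>k. emeasure \<nu> (B (i, k))) = emeasure \<nu> (\<Union>k. B (i, k))"
      proof (rule suminf_emeasure)
        show "range (\<lambda>k. B (i, k)) \<subseteq> sets \<nu>"
          by (auto simp: B_def S cell_def)
        show "disjoint_family (\<lambda>k. B (i, k))"
          unfolding disjoint_family_on_def
        proof (intro ballI impI)
          fix k k' :: nat assume "k \<noteq> k'"
          then have ne: "e k \<noteq> e k'" using bij_is_inj[OF e] by (auto dest: injD)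
          have "cell i (e k) \<inter> cell i (e k') = {}"
          proof (rule ccontr)
            assume "\<not> ?thesis"
            then obtain y where y: "y \<in> cell i (e k)" "y \<in> cell i (e k')" by blast
            have "e k $ j = \<lfloor>y $ j / (1/2)^i\<rfloor>" if "y \<in> cell i (e k)" for k j
            proof -
              have "of_int (e k $ j) \<le> y $ j / (1/2)^i" "y $ j / (1/2)^i < of_int (e k $ j) + 1"
                using that by (auto simp: cell_def cube_def field_simps dest!: spec[of _ j])
              then show ?thesis by linarith
            qed
            then have "e k = e k'" using y by (simp add: vec_eq_iff)
            then show False using ne by simp
          qed
          then show "B (i, k) \<inter> B (i, k') = {}" by (auto simp: B_def)
        qed
      qed
      also have "ennreal (C i) * emeasure \<nu> (\<Union>k. B (i, k)) \<le> ennreal (C i) * emeasure \<nu> (T m)"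
        using S by (intro mult_left_mono emeasure_mono) (auto simp: B_def T_def split: if_splits)
      finally show "(\<Sum>k. ennreal (diameter (B (i, k)) powr l)) \<le> ennreal (C i) * emeasure \<nu> (T m)" .
    qed
    also have "\<dots> = (\<Sum>i. ennreal (C i)) * emeasure \<nu> (T m)" by simp
    finally show ?thesis .
  qed
  have C_eq: "C = (\<lambda>i. real ?n powr l * (real (Suc i) powr (2 * p) * ((1/2)^i) powr (l - d)))"
  proof
    fix i
    have "C i = real ?n powr l * ((1/2)^i) powr l / thr i"
      unfolding C_def by (subst powr_mult) simp_all
    then show "C i = real ?n powr l * (real (Suc i) powr (2 * p) * ((1/2)^i) powr (l - d))"
      by (simp add: thr_def powr_diff powr_minus field_simps)
  qed
  have "summable C"
    unfolding C_eq using l by (intro summable_mult summable_poly_geometric) simp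
  then have Cfin: "(\<Sum>i. ennreal (C i)) \<noteq> top" using C0 by (simp add: suminf_ennreal2)
  have "filterlim (\<lambda>m. m - ?n) at_top sequentially" by (rule filterlim_minus_const_nat_at_top)
  then have "(\<lambda>m. emeasure \<nu> (T m)) \<longlonglongrightarrow> 0"
    unfolding T_def by (rule filterlim_compose[OF finite_measure_tail[OF S fin]])
  then have lim: "(\<lambda>m. (\<Sum>i. ennreal (C i)) * emeasure \<nu> (T m)) \<longlonglongrightarrow> 0"
    using ennreal_tendsto_cmult[of "\<Sum>i. ennreal (C i)"] Cfin by (fastforce simp: less_top)
  show ?thesis
    by (rule tendsto_sandwich[OF _ _ tendsto_const lim]) (auto intro!: always_eventually content)
qed


section \<open>Chaining over scales\<close>

lemma telescope_bound:
  fixes f b :: "nat \<Rightarrow> real"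
  assumes step: "\<And>k. \<bar>f k - f (Suc k)\<bar> \<le> b k" and "summable b"
  shows "\<bar>f 0 - f i\<bar> \<le> suminf b"
proof -
  have "\<bar>f 0 - f i\<bar> = \<bar>\<Sum>k<i. f k - f (Suc k)\<bar>"
    by (simp add: sum_lessThan_telescope')
  also have "\<dots> \<le> (\<Sum>k<i. b k)"
    using step by (intro order_trans[OF sum_abs] sum_mono)
  also have "\<dots> \<le> suminf b"
    using step by (intro sum_le_suminf assms) (auto intro: order_trans[OF abs_ge_zero])
  finally show ?thesis .
qed

lemma grid_corners_close:
  fixes x :: real
  assumes "0 < r" "r \<le> h"
  shows "\<bar>h * of_int \<lfloor>x / h\<rfloor> - r * of_int \<lfloor>x / r\<rfloor>\<bar> \<le> 2 * h"
  using assms floor_times_bounds[of h x] floor_times_bounds[of r x] by linarith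

lemma half_power_scale:
  fixes r :: real assumes "0 < r" "r \<le> 1"
  obtains i where "(1/2)^i / 2 \<le> r" "r \<le> (1/2)^i"
proof -
  define P where "P i \<longleftrightarrow> (1/2)^i / 2 \<le> r" for i :: nat
  obtain j where "(1/2)^j < r" using real_arch_pow_inv[of r "1/2"] assms by auto
  moreover have "(1/2 :: real)^j / 2 \<le> (1/2)^j" by simp
  ultimately have "P j" unfolding P_def by linarith
  then have "P (LEAST i. P i)" by (rule LeastI)
  moreover have "r \<le> (1/2) ^ (LEAST i. P i)"
  proof (cases "LEAST i. P i")
    case 0
    then show ?thesis using assms by simp
  next
    case (Suc k)
    then have "\<not> P k" using not_less_Least[of k P] by simp
    then have "r < (1/2)^k / 2" by (simp only: P_def not_le)
    then show ?thesis using Suc by simp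
  qed
  ultimately show thesis using that by (auto simp: P_def)
qed

text \<open>The chaining argument concerns a set function \<open>m\<close> whose oscillation at scale \<open>h\<close> is controlled by the
  mass that a finite measure gives to a cube of side \<open>h\<close>. It is applied with medians for \<open>m\<close>, the
  energy for \<open>\<nu>\<close>, and \<open>d = n - s * p\<close>.\<close>

locale oscillation_control =
  fixes \<nu> :: "(real^'n) measure" and m :: "(real^'n) set \<Rightarrow> real" and c p d :: real
  assumes c: "0 < c" and p: "0 < p" and d: "0 < d"
    and sets_\<nu>: "sets \<nu> = sets borel" and finite_\<nu>: "emeasure \<nu> UNIV < \<infinity>"
    and oscillation: "\<lbrakk>0 < h; h / 2 \<le> r; r \<le> h; \<And>i. \<bar>a $ i - b $ i\<bar> \<le> 2 * h; 0 < t;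
        emeasure \<nu> (cube a h) < ennreal (c * t powr p * h powr d)\<rbrakk>
       \<Longrightarrow> \<bar>m (cube a h) - m (cube b r)\<bar> \<le> 2 * t"
begin

text \<open>For cells of side \<open>2^k\<close> the oscillation bound \<open>t = \<eta> * \<rho>^k\<close> is used. A bounded mass would permit
  the smaller \<open>t\<close> proportional to \<open>2 powr (- k * d / p)\<close>; using only half of this decay leaves
  an admissible mass that grows with \<open>k\<close>, hence exceeds the total mass of \<open>\<nu>\<close> for large \<open>k\<close>,
  whatever \<open>\<eta>\<close> is.\<close>

definition \<rho> :: real where "\<rho> = 2 powr (- d / (2 * p))"

lemma \<rho>: "0 < \<rho>" "\<rho> < 1"
proof -
  have "- d / (2 * p) < 0" using p d by simp
  then have "2 powr (- d / (2 * p)) < 2 powr (0 :: real)" by (rule powr_less_mono) simp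
  then show "\<rho> < 1" by (simp add: \<rho>_def)
qed (simp add: \<rho>_def)

definition coarse_mass :: "real \<Rightarrow> nat \<Rightarrow> real" where
  "coarse_mass \<eta> k = c * \<eta> powr p * (2 powr (d / 2)) ^ k"

lemma coarse_step:
  assumes "0 < \<eta>" and small: "emeasure \<nu> (grid_cell (2^k) x) < ennreal (coarse_mass \<eta> k)"
    and "2^k / 2 \<le> r" "r \<le> 2^k" "\<And>i. \<bar>2^k * of_int \<lfloor>x $ i / 2^k\<rfloor> - b $ i\<bar> \<le> 2 * 2^k"
  shows "\<bar>m (grid_cell (2^k) x) - m (cube b r)\<bar> \<le> 2 * (\<eta> * \<rho>^k)"
  unfolding grid_cell_def
proof (rule oscillation)
  have "(\<rho>^k) powr p * (2^k) powr d = (2 powr (d / 2)) ^ k"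
  proof -
    have "\<rho>^k = 2 powr (- d / (2 * p) * real k)"
      by (simp only: \<rho>_def powr_powr[symmetric]) (simp add: powr_realpow)
    moreover have "(2::real)^k = 2 powr real k" by (simp add: powr_realpow)
    ultimately have "(\<rho>^k) powr p * (2^k) powr d = 2 powr (- d / (2 * p) * real k * p + real k * d)"
      by (simp only: powr_powr powr_add)
    also have "- d / (2 * p) * real k * p + real k * d = real k * (d / 2)"
      using p by (simp add: field_simps)
    also have "2 powr (real k * (d / 2)) = (2 powr (d / 2)) ^ k"
      by (simp add: powr_realpow[symmetric] powr_powr mult.commute)
    finally show ?thesis .
  qed
  then have "coarse_mass \<eta> k = c * (\<eta> * \<rho>^k) powr p * (2^k) powr d"
    using \<open>0 < \<eta>\<close> \<rho> by (simp add: coarse_mass_def powr_mult)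
  then show "emeasure \<nu> (cube (\<chi> i. 2^k * of_int \<lfloor>x $ i / 2^k\<rfloor>) (2^k))
      < ennreal (c * (\<eta> * \<rho>^k) powr p * (2^k) powr d)"
    using small by (simp add: grid_cell_def)
qed (use assms \<rho> in auto)

lemma coarse_neighbour:
  assumes "0 < \<eta>" and "emeasure \<nu> (grid_cell (2^Suc k) x) < ennreal (coarse_mass \<eta> (Suc k))"
  shows "\<bar>m (grid_cell (2^k) x) - m (grid_cell (2^Suc k) x)\<bar> \<le> 2 * (\<eta> * \<rho>^Suc k)"
proof -
  have "\<bar>2^Suc k * of_int \<lfloor>x $ i / 2^Suc k\<rfloor> - 2^k * of_int \<lfloor>x $ i / 2^k\<rfloor>\<bar> \<le> 2 * (2^Suc k :: real)" for i
    by (rule grid_corners_close) simp_all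
  then have "\<bar>m (grid_cell (2^Suc k) x) - m (grid_cell (2^k) x)\<bar> \<le> 2 * (\<eta> * \<rho>^Suc k)"
    unfolding grid_cell_def[of "2^k"] by (intro coarse_step assms) simp_all
  then show ?thesis by (simp add: abs_minus_commute)
qed

lemma coarse_mass_eventually:
  assumes "0 < \<eta>"
  obtains J where "\<And>k A. J \<le> k \<Longrightarrow> emeasure \<nu> A < ennreal (coarse_mass \<eta> k)"
proof -
  define M where "M = measure \<nu> UNIV"
  have M: "emeasure \<nu> A \<le> ennreal M" for A
  proof -
    have "emeasure \<nu> A \<le> emeasure \<nu> UNIV"
      using sets_\<nu> by (intro emeasure_mono) auto
    also have "\<dots> = ennreal M"
      using finite_\<nu> unfolding M_def by (intro emeasure_eq_ennreal_measure) auto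
    finally show ?thesis .
  qed
  have b: "1 < 2 powr (d / 2)" using d by simp
  obtain J where J: "M / (c * \<eta> powr p) < (2 powr (d / 2)) ^ J"
    using real_arch_pow[OF b] by blast
  show thesis
  proof (rule that)
    fix k A assume "J \<le> k"
    then have "(2 powr (d / 2)) ^ J \<le> (2 powr (d / 2)) ^ k"
      using b by (intro power_increasing) auto
    with J have "M / (c * \<eta> powr p) < (2 powr (d / 2)) ^ k" by linarith
    then have "M < coarse_mass \<eta> k"
      using c assms by (simp add: coarse_mass_def field_simps)
    then have "ennreal M < ennreal (coarse_mass \<eta> k)"
      by (intro ennreal_lessI) (auto simp: M_def intro: le_less_trans[OF measure_nonneg])
    then show "emeasure \<nu> A < ennreal (coarse_mass \<eta> k)"
      using M[of A] by (rule le_less_trans[rotated])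
  qed
qed

text \<open>At a fixed point the large cells give a geometrically convergent chain because \<open>d > 0\<close>. The limit
  is the same for all points, since cells of side \<open>2^k\<close> about \<open>x\<close> and about \<open>0\<close> are comparable once
  \<open>norm x \<le> 2^k\<close>. This limit is the value at infinity.\<close>

lemma coarse_limit:
  obtains K where "\<And>x. (\<lambda>k. m (grid_cell (2^k) x)) \<longlonglongrightarrow> K"
proof -
  obtain J where J: "\<And>k A. J \<le> k \<Longrightarrow> emeasure \<nu> A < ennreal (coarse_mass 1 k)"
    using coarse_mass_eventually[of 1] by auto
  define a where "a k = m (grid_cell (2^k) 0)" for k
  have "summable (\<lambda>k. a (Suc k) - a k)"
  proof (rule summable_comparison_test')
    show "summable (\<lambda>k. 2 * (1 * \<rho>^Suc k))"
      using \<rho> by (intro summable_mult) (simp add: summable_Suc_iff summable_geometric)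
    fix k assume "J \<le> k"
    then show "norm (a (Suc k) - a k) \<le> 2 * (1 * \<rho>^Suc k)"
      using coarse_neighbour[of 1 k 0] J[of "Suc k"] by (simp add: a_def abs_minus_commute)
  qed
  then have "(\<lambda>n. \<Sum>k<n. a (Suc k) - a k) \<longlonglongrightarrow> (\<Sum>k. a (Suc k) - a k)"
    by (rule summable_LIMSEQ)
  then have "(\<lambda>n. (a n - a 0) + a 0) \<longlonglongrightarrow> (\<Sum>k. a (Suc k) - a k) + a 0"
    unfolding sum_lessThan_telescope by (intro tendsto_add tendsto_const)
  then obtain K where K: "a \<longlonglongrightarrow> K" by auto
  show thesis
  proof (rule that)
    fix x :: "real^'n"
    obtain L where L: "norm x < 2^L" using real_arch_pow[of 2 "norm x"] by auto
    have "\<bar>m (grid_cell (2^k) x) - a k\<bar> \<le> 2 * (1 * \<rho>^k)" if k: "max J L \<le> k" for k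
      unfolding a_def grid_cell_def[of _ 0]
    proof (rule coarse_step)
      show "emeasure \<nu> (grid_cell (2^k) x) < ennreal (coarse_mass 1 k)" using J k by simp
      fix i
      have "(2::real)^L \<le> 2^k" using k by (intro power_increasing) auto
      then have "\<bar>x $ i\<bar> \<le> 2^k" using L component_le_norm_cart[of x i] by linarith
      then show "\<bar>(2::real)^k * of_int \<lfloor>x $ i / 2^k\<rfloor> - (\<chi> i. 2^k * of_int \<lfloor>(0::real^'n) $ i / 2^k\<rfloor>) $ i\<bar> \<le> 2 * 2^k"
        using floor_times_bounds[of "2^k" "x $ i"] by simp
    qed simp_all
    then have "\<forall>\<^sub>F k in sequentially. norm (m (grid_cell (2^k) x) - a k) \<le> 2 * (1 * \<rho>^k)"
      unfolding eventually_sequentially by (intro exI[of _ "max J L"]) auto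
    moreover have "(\<lambda>k. 2 * (1 * \<rho>^k)) \<longlonglongrightarrow> 0"
      using \<rho> by (auto intro!: tendsto_mult_right_zero LIMSEQ_realpow_zero)
    ultimately have "(\<lambda>k. m (grid_cell (2^k) x) - a k) \<longlonglongrightarrow> 0"
      by (rule Lim_null_comparison)
    from tendsto_add[OF this K] show "(\<lambda>k. m (grid_cell (2^k) x)) \<longlonglongrightarrow> K" by simp
  qed
qed

lemma coarse_close:
  assumes "0 < \<eta>" and small: "\<And>k. emeasure \<nu> (grid_cell (2^k) x) < ennreal (coarse_mass \<eta> k)"
    and K: "(\<lambda>k. m (grid_cell (2^k) x)) \<longlonglongrightarrow> K"
  shows "\<bar>m (grid_cell 1 x) - K\<bar> \<le> \<eta> * (2 * (\<Sum>k. \<rho>^Suc k))"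
proof -
  have s: "summable (\<lambda>k. \<rho>^Suc k)"
    using \<rho> by (simp only: summable_Suc_iff) (simp add: summable_geometric)
  have "\<bar>m (grid_cell (2^0) x) - m (grid_cell (2^k) x)\<bar> \<le> (\<Sum>k. 2 * (\<eta> * \<rho>^Suc k))" for k
    using s by (intro telescope_bound coarse_neighbour assms summable_mult)
  moreover have "(\<Sum>k. 2 * (\<eta> * \<rho>^Suc k)) = \<eta> * (2 * (\<Sum>k. \<rho>^Suc k))"
    using s by (simp only: suminf_mult summable_mult mult.left_commute)
  ultimately have bd: "\<bar>m (grid_cell 1 x) - m (grid_cell (2^k) x)\<bar> \<le> \<eta> * (2 * (\<Sum>k. \<rho>^Suc k))" for k
    by simp
  show ?thesis
    by (rule tendsto_upperbound[OF tendsto_rabs[OF tendsto_diff[OF tendsto_const K]]])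
      (use bd in auto)
qed

text \<open>The large cells are harmless by their size, and the finitely many remaining scales because their
  cells recede to infinity with \<open>x\<close>, where \<open>\<nu>\<close> has little mass.\<close>

lemma coarse_far:
  assumes "0 < \<eta>"
  obtains R where "\<And>x k. R < norm x \<Longrightarrow> emeasure \<nu> (grid_cell (2^k) x) < ennreal (coarse_mass \<eta> k)"
proof -
  obtain J where J: "\<And>k A. J \<le> k \<Longrightarrow> emeasure \<nu> A < ennreal (coarse_mass \<eta> k)"
    using coarse_mass_eventually[OF assms] by auto
  have "0 < c * \<eta> powr p" using c assms by simp
  then have "\<forall>\<^sub>F k in sequentially. emeasure \<nu> (- ball 0 (real k)) < ennreal (c * \<eta> powr p)"
    by (intro order_tendstoD(2)[OF finite_measure_tail[OF sets_\<nu> finite_\<nu>]]) simp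
  then obtain r :: nat where r: "emeasure \<nu> (- ball 0 (real r)) < ennreal (c * \<eta> powr p)"
    by (auto simp: eventually_sequentially)
  show thesis
  proof (rule that)
    fix x :: "real^'n" and k
    assume x: "real r + real CARD('n) * 2^J < norm x"
    show "emeasure \<nu> (grid_cell (2^k) x) < ennreal (coarse_mass \<eta> k)"
    proof (cases "J \<le> k")
      case False
      have "real CARD('n) * 2^k \<le> real CARD('n) * 2^J"
        using False by (intro mult_left_mono power_increasing) auto
      then have "real r + real CARD('n) * 2^k \<le> norm x" using x by linarith
      then have "grid_cell (2^k) x \<subseteq> - ball 0 (real r)"
        by (intro grid_cell_subset_far) auto
      then have "emeasure \<nu> (grid_cell (2^k) x) \<le> emeasure \<nu> (- ball 0 (real r))"
        using sets_\<nu> by (intro emeasure_mono) auto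
      also note r
      also have "ennreal (c * \<eta> powr p) \<le> ennreal (coarse_mass \<eta> k)"
      proof -
        have "1 \<le> (2 powr (d / 2)) ^ k"
          using d by (intro one_le_power ge_one_powr_ge_zero) auto
        then have "c * \<eta> powr p * 1 \<le> coarse_mass \<eta> k"
          unfolding coarse_mass_def using c by (intro mult_left_mono) auto
        then show ?thesis by (simp add: ennreal_leI)
      qed
      finally show ?thesis .
    qed (use J in auto)
  qed
qed

definition fine_constant :: real where
  "fine_constant = (\<Sum>i. 2 / real (Suc i)^2) + 2"

lemma fine_summable: "summable (\<lambda>i. 2 / real (Suc i)^2)"
proof -
  have "summable (\<lambda>i. inverse (real (Suc i) ^ 2))"
    using inverse_power_summable[of 2, where ?'a = real] by (subst summable_Suc_iff) auto
  from summable_mult[OF this, of 2] show ?thesis by (simp add: divide_inverse)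
qed

text \<open>The chain of cells of sides \<open>1, 1/2, 1/4, \<dots>\<close> about \<open>x\<close>, followed by one comparison of the cell
  of the right scale with an arbitrary cube containing \<open>x\<close>.\<close>

lemma fine_close:
  assumes "0 < \<eta>" and small: "\<And>i. emeasure \<nu> (grid_cell ((1/2)^i) x)
      < ennreal (c * (\<eta> / real (Suc i)^2) powr p * ((1/2)^i) powr d)"
    and "x \<in> cube b r" "0 < r" "r \<le> 1"
  shows "\<bar>m (grid_cell 1 x) - m (cube b r)\<bar> \<le> \<eta> * fine_constant"
proof -
  have pos: "0 < \<eta> / real (Suc i)^2" for i using \<open>0 < \<eta>\<close> by simp
  have "\<bar>m (grid_cell ((1/2)^i) x) - m (grid_cell ((1/2)^Suc i) x)\<bar> \<le> \<eta> * (2 / real (Suc i)^2)" for i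
  proof -
    have "\<bar>m (grid_cell ((1/2)^i) x) - m (grid_cell ((1/2)^Suc i) x)\<bar> \<le> 2 * (\<eta> / real (Suc i)^2)"
      unfolding grid_cell_def
    proof (rule oscillation[OF _ _ _ _ pos small[unfolded grid_cell_def]])
      fix j
      show "\<bar>(\<chi> j. (1/2::real)^i * of_int \<lfloor>x $ j / (1/2)^i\<rfloor>) $ j
          - (\<chi> j. (1/2)^Suc i * of_int \<lfloor>x $ j / (1/2)^Suc i\<rfloor>) $ j\<bar> \<le> 2 * (1/2)^i"
        unfolding vec_lambda_beta by (rule grid_corners_close) simp_all
    qed simp_all
    then show ?thesis by (simp add: mult.commute)
  qed
  then have chain: "\<bar>m (grid_cell ((1/2)^0) x) - m (grid_cell ((1/2)^i) x)\<bar>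
      \<le> (\<Sum>i. \<eta> * (2 / real (Suc i)^2))" for i
    by (intro telescope_bound summable_mult fine_summable)
  obtain i where i: "(1/2)^i / 2 \<le> r" "r \<le> (1/2)^i"
    using half_power_scale \<open>0 < r\<close> \<open>r \<le> 1\<close> by blast
  have "\<bar>m (grid_cell ((1/2)^i) x) - m (cube b r)\<bar> \<le> 2 * (\<eta> / real (Suc i)^2)"
    unfolding grid_cell_def
  proof (rule oscillation[OF _ i _ pos small[unfolded grid_cell_def]])
    fix j
    have "b $ j \<le> x $ j" "x $ j < b $ j + r" using assms by (auto simp: cube_def)
    then show "\<bar>(\<chi> j. (1/2::real)^i * of_int \<lfloor>x $ j / (1/2)^i\<rfloor>) $ j - b $ j\<bar> \<le> 2 * (1/2)^i"
      unfolding vec_lambda_beta using floor_times_bounds[of "(1/2)^i" "x $ j"] i by auto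
  qed simp
  also have "\<dots> \<le> \<eta> * 2"
  proof -
    have "1 \<le> real (Suc i)^2" by (rule one_le_power) simp
    then have "\<eta> / real (Suc i)^2 \<le> \<eta>" using \<open>0 < \<eta>\<close> by (simp add: divide_le_eq mult_le_cancel_left1)
    then show ?thesis by simp
  qed
  finally have "\<bar>m (grid_cell 1 x) - m (cube b r)\<bar> \<le> (\<Sum>i. \<eta> * (2 / real (Suc i)^2)) + \<eta> * 2"
    using chain[of i] unfolding power_0 by linarith
  also have "(\<Sum>i. \<eta> * (2 / real (Suc i)^2)) = \<eta> * (\<Sum>i. 2 / real (Suc i)^2)"
    by (intro suminf_mult fine_summable)
  finally show ?thesis by (simp only: fine_constant_def distrib_left)
qed

text \<open>The exceptional set is formed from the weighted measure. At any other point \<open>x\<close> far out, the weight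
  turns the fixed threshold into the small one that the chain of fine cells asks for, while the chain
  of coarse cells joins the unit cell at \<open>x\<close> to \<open>K\<close>.\<close>

lemma limit_off_thin_set:
  obtains E K where
    "\<And>l. \<lbrakk>0 < l; d < l\<rbrakk> \<Longrightarrow> (\<lambda>k::nat. hausdorff_content l (E \<inter> - ball 0 (real k))) \<longlonglongrightarrow> 0"
    "\<And>\<epsilon>. 0 < \<epsilon> \<Longrightarrow> \<exists>R>0. \<forall>x b r. x \<notin> E \<and> R < norm x \<and> x \<in> cube b r \<and> 0 < r \<and> r \<le> 1
        \<longrightarrow> \<bar>m (cube b r) - K\<bar> \<le> \<epsilon>"
proof -
  obtain \<nu>' where \<nu>': "sets \<nu>' = sets borel" "emeasure \<nu>' UNIV < \<infinity>"
    and weight: "\<And>N::nat. \<exists>R. \<forall>A\<in>sets borel. A \<subseteq> - ball 0 R \<longrightarrow> of_nat N * emeasure \<nu> A \<le> emeasure \<nu>' A"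
    using weighted_measure[OF sets_\<nu> finite_\<nu>] by blast
  obtain K where K: "\<And>x. (\<lambda>k. m (grid_cell (2^k) x)) \<longlonglongrightarrow> K"
    using coarse_limit by blast
  define E where "E = bad_points p d \<nu>'"
  define C where "C = 2 * (\<Sum>k. \<rho>^Suc k) + fine_constant"
  have "0 \<le> (\<Sum>k. \<rho>^Suc k)"
    using \<rho> by (intro suminf_nonneg) (auto simp: summable_Suc_iff summable_geometric simp del: power_Suc)
  moreover have "0 \<le> (\<Sum>i. 2 / real (Suc i)^2)"
    by (intro suminf_nonneg fine_summable) auto
  ultimately have C: "0 < C" by (simp add: C_def fine_constant_def)
  have "\<exists>R>0. \<forall>x b r. x \<notin> E \<and> R < norm x \<and> x \<in> cube b r \<and> 0 < r \<and> r \<le> 1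
        \<longrightarrow> \<bar>m (cube b r) - K\<bar> \<le> \<epsilon>" if "0 < \<epsilon>" for \<epsilon>
  proof -
    define \<eta> where "\<eta> = \<epsilon> / C"
    have \<eta>: "0 < \<eta>" using that C by (simp add: \<eta>_def)
    obtain R1 where R1: "\<And>x k. R1 < norm x \<Longrightarrow> emeasure \<nu> (grid_cell (2^k) x) < ennreal (coarse_mass \<eta> k)"
      using coarse_far[OF \<eta>] by blast
    \<comment> \<open>Where the weight is at least \<open>N\<close>, a cell below the threshold for \<open>\<nu>'\<close> is below \<open>c * \<eta> powr p\<close> times
      that threshold for \<open>\<nu>\<close>.\<close>
    obtain N :: nat where "1 / (c * \<eta> powr p) < real N" using reals_Archimedean2 by blast
    then have N: "1 \<le> real N * (c * \<eta> powr p)" using c \<eta> by (simp add: field_simps)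
    obtain R2 where R2: "\<And>A. A \<in> sets borel \<Longrightarrow> A \<subseteq> - ball 0 R2 \<Longrightarrow> of_nat N * emeasure \<nu> A \<le> emeasure \<nu>' A"
      using weight[of N] by blast
    define R where "R = max 1 (max R1 (R2 + real CARD('n)))"
    have "\<bar>m (cube b r) - K\<bar> \<le> \<epsilon>"
      if x: "x \<notin> E" "R < norm x" "x \<in> cube b r" "0 < r" "r \<le> 1" for x b r
    proof -
      have "emeasure \<nu> (grid_cell ((1/2)^i) x)
        < ennreal (c * (\<eta> / real (Suc i)^2) powr p * ((1/2)^i) powr d)" for i
      proof (rule ccontr)
        define thr where "thr = real (Suc i) powr (- 2 * p) * ((1/2)^i) powr d"
        have thr: "0 \<le> thr" by (simp add: thr_def)
        have "real (Suc i)^2 = real (Suc i) powr 2" by simp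
        then have "(real (Suc i)^2) powr p = real (Suc i) powr (2 * p)"
          by (simp only: powr_powr)
        then have eq: "c * (\<eta> / real (Suc i)^2) powr p * ((1/2)^i) powr d = c * \<eta> powr p * thr"
          using \<eta> by (simp add: thr_def powr_divide powr_minus_divide del: of_nat_Suc)
        assume "\<not> ?thesis"
        then have ge: "ennreal (c * \<eta> powr p * thr) \<le> emeasure \<nu> (grid_cell ((1/2)^i) x)"
          by (simp only: eq not_less)
        have "1 * thr \<le> real N * (c * \<eta> powr p) * thr" using N thr by (rule mult_right_mono)
        then have "ennreal thr \<le> ennreal (real N * (c * \<eta> powr p * thr))"
          by (intro ennreal_leI) (simp add: mult.assoc)
        also have "\<dots> = of_nat N * ennreal (c * \<eta> powr p * thr)"
          using c thr by (simp add: ennreal_mult ennreal_of_nat_eq_real_of_nat)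
        also have "\<dots> \<le> of_nat N * emeasure \<nu> (grid_cell ((1/2)^i) x)"
          by (intro mult_left_mono ge) simp
        also have "\<dots> \<le> emeasure \<nu>' (grid_cell ((1/2)^i) x)"
        proof (rule R2)
          show "grid_cell ((1/2)^i) x \<in> sets borel" by (simp add: grid_cell_def)
          have "real CARD('n) * (1/2)^i \<le> real CARD('n) * 1"
            by (intro mult_left_mono power_le_one) auto
          moreover have "R2 + real CARD('n) \<le> norm x" using x(2) by (simp add: R_def)
          ultimately have "R2 + real CARD('n) * (1/2)^i \<le> norm x" by linarith
          then show "grid_cell ((1/2)^i) x \<subseteq> - ball 0 R2"
            by (intro grid_cell_subset_far) auto
        qed
        finally show False using x(1) by (auto simp: E_def bad_points_def thr_def)
      qed
      then have "\<bar>m (grid_cell 1 x) - m (cube b r)\<bar> \<le> \<eta> * fine_constant"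
        using x by (intro fine_close[OF \<eta>])
      moreover have "\<bar>m (grid_cell 1 x) - K\<bar> \<le> \<eta> * (2 * (\<Sum>k. \<rho>^Suc k))"
        using x by (intro coarse_close[OF \<eta> R1 K]) (simp add: R_def)
      moreover have "\<eta> * (2 * (\<Sum>k. \<rho>^Suc k)) + \<eta> * fine_constant = \<epsilon>"
      proof -
        have "\<eta> * C = \<epsilon>" using C by (simp add: \<eta>_def)
        then show ?thesis by (simp only: C_def distrib_left)
      qed
      ultimately show ?thesis by linarith
    qed
    moreover have "0 < R" by (simp add: R_def)
    ultimately show ?thesis by blast
  qed
  then show thesis
    using bad_points_content[OF \<nu>'] by (intro that[of E K]) (auto simp: E_def)
qed

end

section \<open>Precise representatives\<close>

lemma precise_rep_close:
  fixes u :: "real^'n \<Rightarrow> real"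
  assumes close: "\<And>b r. \<lbrakk>x \<in> cube b r; 0 < r; r \<le> 1\<rbrakk> \<Longrightarrow> \<bar>median u (cube b r) - K\<bar> \<le> \<epsilon>"
  shows "\<bar>precise_rep u x - ereal K\<bar> \<le> ereal \<epsilon>"
proof -
  let ?A = "\<lambda>\<delta>. {Q \<in> cubes. x \<in> Q \<and> measure lebesgue Q < \<delta>}"
  have up: "(SUP Q\<in>?A 1. ereal (median u Q)) \<le> ereal (K + \<epsilon>)"
  proof (rule SUP_least)
    fix Q assume "Q \<in> ?A 1"
    then obtain b r where Q: "Q = cube b r" "0 < r" "x \<in> cube b r" "r ^ CARD('n) < 1"
      by (auto simp: cubes_eq measure_cube)
    then have "r \<le> 1" using one_le_power[of r "CARD('n)"] by linarith
    then show "ereal (median u Q) \<le> ereal (K + \<epsilon>)" using close[of b r] Q by auto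
  qed
  have low: "ereal (K - \<epsilon>) \<le> (SUP Q\<in>?A \<delta>. ereal (median u Q))" if "0 < \<delta>" for \<delta>
  proof -
    define r where "r = min 1 \<delta> / 2"
    have r: "0 < r" "r \<le> 1" "r < \<delta>" using that by (auto simp: r_def)
    have "r ^ CARD('n) \<le> r ^ 1" using r by (intro power_decreasing) auto
    moreover have x: "x \<in> cube x r" using r by (simp add: cube_def)
    ultimately have "cube x r \<in> ?A \<delta>"
      using r by (auto simp: cubes_eq measure_cube)
    then show ?thesis using close[of x r] x r by (intro SUP_upper2[of "cube x r"]) auto
  qed
  have "precise_rep u x \<le> ereal (K + \<epsilon>)"
    unfolding precise_rep_def using up by (intro INF_lower2[of 1]) auto
  moreover have "ereal (K - \<epsilon>) \<le> precise_rep u x"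
    unfolding precise_rep_def using low by (intro INF_greatest) auto
  ultimately show ?thesis by (cases "precise_rep u x") auto
qed

text \<open>Medians and integrals do not change when \<open>u\<close> is altered on a null set. With a Borel measurable
  representative the slice energy is Borel measurable, and the completion of the measure disappears
  from all later arguments.\<close>

lemma borel_representative:
  fixes u :: "real^'n \<Rightarrow> real"
  assumes u: "u \<in> borel_measurable lebesgue" and fin: "W_seminorm s p q u < \<infinity>"
  obtains v where "v \<in> borel_measurable borel" "precise_rep v = precise_rep u"
    "emeasure (energy s p q v) UNIV < \<infinity>"
proof -
  obtain v where v: "v \<in> borel_measurable lborel" "AE x in lborel. u x = v x"
    using completion_ex_borel_measurable_real[OF u] by blast
  then have [measurable]: "v \<in> borel_measurable borel" by simp
  have ae: "AE x in lebesgue. u x = v x" using v(2) by (rule AE_completion)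
  have vl: "v \<in> borel_measurable lebesgue" using v(1) by (rule measurable_completion)
  have "median v Q = median u Q" if "Q \<in> cubes" for Q
  proof -
    have Q: "Q \<in> sets lebesgue" using that by (auto simp: cubes_eq)
    have "measure lebesgue {x \<in> Q. v x < M} = measure lebesgue {x \<in> Q. u x < M}" for M
    proof (rule measure_eq_AE)
      have "{x \<in> space lebesgue. x \<in> Q \<and> w x < M} \<in> sets lebesgue"
        if "w \<in> borel_measurable lebesgue" for w :: "real^'n \<Rightarrow> real"
        using that Q by measurable
      from this[OF u] this[OF vl]
      show "{x \<in> Q. v x < M} \<in> sets lebesgue" "{x \<in> Q. u x < M} \<in> sets lebesgue" by auto
      show "AE x in lebesgue. (x \<in> {x \<in> Q. v x < M}) = (x \<in> {x \<in> Q. u x < M})"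
        using ae by eventually_elim auto
    qed
    then show ?thesis by (simp add: median_def)
  qed
  then have rep: "precise_rep v = precise_rep u"
    unfolding precise_rep_def by (intro ext INF_cong SUP_cong refl) auto
  let ?I = "\<lambda>x. \<integral>\<^sup>+ y. ennreal (\<bar>u x - u y\<bar> powr q / norm (x - y) powr (real CARD('n) + s * q)) \<partial>lebesgue"
  have "AE x in lborel. ennreal_powr (slice_energy s q v x) (p / q) = ennreal_powr (?I x) (p / q)"
    using v(2)
  proof eventually_elim
    case (elim x)
    have "slice_energy s q v x = ?I x"
      unfolding slice_energy_def nn_integral_completion
      by (rule nn_integral_cong_AE) (use v(2) elim in \<open>auto elim!: eventually_mono\<close>)
    then show ?case by simp
  qed
  then have "(\<integral>\<^sup>+ x. ennreal_powr (slice_energy s q v x) (p / q) \<partial>lborel)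
      = (\<integral>\<^sup>+ x. ennreal_powr (?I x) (p / q) \<partial>lebesgue)"
    unfolding nn_integral_completion by (rule nn_integral_cong_AE)
  also have "\<dots> < \<infinity>"
    using fin unfolding W_seminorm_def ennreal_powr_def[of _ "1 / p"]
    by (auto split: if_splits simp: less_top)
  finally have "emeasure (energy s p q v) UNIV < \<infinity>"
    unfolding energy_def by (subst emeasure_density) auto
  then show thesis using that[of v] rep by simp
qed

theorem theorem1p1:
  fixes s p q :: real and ustar :: "real^'n \<Rightarrow> ereal"
  assumes "CARD('n) \<ge> 2"
    and "0 < s" and "s < 1"
    and "0 < p" and "0 < q"
    and "s * p < real CARD('n)"
    and "ustar \<in> W_dot s p q"
  shows "\<exists>(E :: (real^'n) set) (K :: real). thin_at_infinity p s E \<and>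
    (\<forall>\<epsilon>::real. \<epsilon> > 0 \<longrightarrow> (\<exists>R>0. \<forall>x. x \<notin> E \<and> norm x > R \<longrightarrow> \<bar>ustar x - ereal K\<bar> < ereal \<epsilon>))"
proof -
  obtain u where "ustar = precise_rep u" "u \<in> borel_measurable lebesgue" "W_seminorm s p q u < \<infinity>"
    using assms(7) by (auto simp: W_dot_def)
  then obtain v where v: "v \<in> borel_measurable borel" "ustar = precise_rep v"
    "emeasure (energy s p q v) UNIV < \<infinity>"
    using borel_representative by metis
  obtain c where c: "0 < c"
    "\<And>(u::real^'n \<Rightarrow> real) a b h r t.
       \<lbrakk>u \<in> borel_measurable borel; 0 < h; h / 2 \<le> r; r \<le> h; \<And>i. \<bar>a $ i - b $ i\<bar> \<le> 2 * h; 0 < t;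
        emeasure (energy s p q u) (cube a h) < ennreal (c * t powr p * h powr (real CARD('n) - s * p))\<rbrakk>
       \<Longrightarrow> \<bar>median u (cube a h) - median u (cube b r)\<bar> \<le> 2 * t"
    using cube_oscillation[OF assms(2,4,5)] by metis
  interpret oscillation_control "energy s p q v" "median v" c p "real CARD('n) - s * p"
    using assms v c by unfold_locales auto
  obtain E K where
    thin: "\<And>l. \<lbrakk>0 < l; real CARD('n) - s * p < l\<rbrakk>
      \<Longrightarrow> (\<lambda>k::nat. hausdorff_content l (E \<inter> - ball 0 (real k))) \<longlonglongrightarrow> 0"
    and close: "\<And>\<epsilon>. 0 < \<epsilon> \<Longrightarrow> \<exists>R>0. \<forall>x b r. x \<notin> E \<and> R < norm x \<and> x \<in> cube b r \<and> 0 < r \<and> r \<le> 1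
        \<longrightarrow> \<bar>median v (cube b r) - K\<bar> \<le> \<epsilon>"
    using limit_off_thin_set by blast
  have "\<exists>R>0. \<forall>x. x \<notin> E \<and> norm x > R \<longrightarrow> \<bar>ustar x - ereal K\<bar> < ereal \<epsilon>" if "0 < \<epsilon>" for \<epsilon>
  proof -
    obtain R where R: "0 < R" "\<And>x b r. \<lbrakk>x \<notin> E; R < norm x; x \<in> cube b r; 0 < r; r \<le> 1\<rbrakk>
        \<Longrightarrow> \<bar>median v (cube b r) - K\<bar> \<le> \<epsilon> / 2"
      using close[of "\<epsilon> / 2"] \<open>0 < \<epsilon>\<close> by auto
    have "\<bar>ustar x - ereal K\<bar> < ereal \<epsilon>" if "x \<notin> E" "R < norm x" for x
    proof -
      have "\<bar>ustar x - ereal K\<bar> \<le> ereal (\<epsilon> / 2)"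
        unfolding v(2) using R(2) that by (intro precise_rep_close)
      also have "\<dots> < ereal \<epsilon>" using \<open>0 < \<epsilon>\<close> by simp
      finally show ?thesis .
    qed
    then show ?thesis using R(1) by blast
  qed
  then show ?thesis using thin unfolding thin_at_infinity_def by blast
qed

end
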